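(* Let $T$ be a Borel automorphism of $\mathbb{R}^n$ and let $\{\theta_j : 0 \le j \le n\} \subset \mathbb{R}^n$ be a set of $n+1$ points such that $\{\theta_j - \theta_0 : 1 \le j \le n\}$ is a basis for $\mathbb{R}^n$. Suppose there exists an $n \times n$ nonsingular covariance matrix $\Sigma \in \mathcal{S}_+(n)$ such that $$N(\theta_j, \Sigma)\,T^{-1} = N(\varphi_j, \Psi_j), \qquad 0 \le j \le n,$$ for some $\varphi_j \in \mathbb{R}^n$ and $\Psi_j \in \mathcal{S}_+(n)$. Then $T$ is an affine automorphism, i.e. there exist a real nonsingular $n \times n$ matrix $A$ and $a \in \mathbb{R}^n$ such that $T(x) = Ax + a$ for Lebesgue-almost every $x \in \mathbb{R}^n$.
   Context: A Borel automorphism of $\mathbb{R}^n$ is a bijection $T:\mathbb{R}^n \to \mathbb{R}^n$ such that both $T$ and $T^{-1}$ are Borel measurable. $\mathcal{S}_+(n)$ is the set of real symmetric positive definite $n \times n$ matrices. For $\theta \in \mathbb{R}^n$ and $\Sigma \in \mathcal{S}_+(n)$, $N(\theta,\Sigma)$ is the Gaussian probability measure on $\mathbb{R}^n$ with mean $\theta$ and covariance matrix $\Sigma$, i.e. with density $(2\pi)^{-n/2}|\Sigma|^{-1/2}\exp\left(-\tfrac12 (x-\theta)'\Sigma^{-1}(x-\theta)\right)$. For a measure $\mu$, $\mu T^{-1}$ denotes the push-forward $E \mapsto \mu(T^{-1}(E))$. *)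

theory Defs
  imports "HOL-Analysis.Analysis"
begin

definition borel_automorphism :: "('a::topological_space \<Rightarrow> 'a) \<Rightarrow> bool" where
  "borel_automorphism T \<longleftrightarrow>
     bij T \<and> T \<in> borel_measurable borel \<and> inv T \<in> borel_measurable borel"

definition sym_pos_def :: "(real ^ 'n ^ 'n) set" where
  "sym_pos_def = {S. transpose S = S \<and> (\<forall>x. x \<noteq> 0 \<longrightarrow> x \<bullet> (S *v x) > 0)}"

text \<open>The density formula is only meaningful for a symmetric positive definite covariance
  matrix; for other matrices the value is irrelevant.\<close>

definition gaussian_density ::
    "real ^ 'n \<Rightarrow> real ^ 'n ^ 'n \<Rightarrow> real ^ 'n \<Rightarrow> real" where
  "gaussian_density m S x =
     (2 * pi) powr (- real CARD('n) / 2) * det S powr (- 1 / 2) *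
     exp (- (1 / 2) * ((x - m) \<bullet> (matrix_inv S *v (x - m))))"

definition gaussian_measure ::
    "real ^ 'n \<Rightarrow> real ^ 'n ^ 'n \<Rightarrow> (real ^ 'n) measure" where
  "gaussian_measure m S = density lborel (\<lambda>x. ennreal (gaussian_density m S x))"

end

theory Submission
  imports Defs "HOL-Probability.Distributions"
begin

text \<open>
  Write \<open>f\<^sub>j\<close> for the density of \<open>N(\<theta>\<^sub>j, \<Sigma>)\<close> and \<open>g\<^sub>j\<close> for the density of its image
  \<open>N(\<phi>\<^sub>j, \<Psi>\<^sub>j)\<close>.  Since \<open>T\<close> is a Borel isomorphism, it carries likelihood ratios to likelihood
  ratios: \<open>f\<^sub>j / f\<^sub>0 = (g\<^sub>j / g\<^sub>0) \<circ> T\<close> almost everywhere (\<open>density_ratio_transported\<close>).  Taking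
  logarithms gives \<open>l\<^sub>j = q\<^sub>j \<circ> T\<close>, where \<open>l\<^sub>j\<close> is affine with linear part \<open>\<Sigma>\<^sup>-\<^sup>1(\<theta>\<^sub>j - \<theta>\<^sub>0)\<close>, because
  both source densities have the same covariance, while \<open>q\<^sub>j\<close> is a priori quadratic, with quadratic
  part \<open>(\<Psi>\<^sub>0\<^sup>-\<^sup>1 - \<Psi>\<^sub>j\<^sup>-\<^sup>1) / 2\<close>.

  The heart of the proof is that \<open>q\<^sub>j\<close> is affine too (\<open>image_covariance_inverse_eq\<close>).  An affine
  function of a Gaussian vector has exponential moments of every order, of either sign, so
  \<open>exp (t q\<^sub>j)\<close> is integrable against \<open>N(\<phi>\<^sub>0, \<Psi>\<^sub>0)\<close> for every real \<open>t\<close>.  If the quadratic part of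
  \<open>q\<^sub>j\<close> were nonzero at some vector \<open>v\<close>, a suitable \<open>t\<close> would make the exponent
  \<open>t q\<^sub>j + ln g\<^sub>0\<close> strictly convex in the direction \<open>v\<close>, and the exponential of a quadratic of
  that kind is never integrable (\<open>nn_integral_exp_eq_top_if_second_difference_pos\<close>).

  So for each \<open>w\<close> among the spanning vectors \<open>\<theta>\<^sub>j - \<theta>\<^sub>0\<close>, the function
  \<open>x \<mapsto> \<Sigma>\<^sup>-\<^sup>1 w \<bullet> x\<close> is almost everywhere an affine function of \<open>T x\<close>; by linearity this holds for
  every \<open>w\<close>, in particular for those with \<open>\<Sigma>\<^sup>-\<^sup>1 w\<close> a coordinate vector.  Hence
  \<open>x = N (T x) + d\<close> almost everywhere.  The matrix \<open>N\<close> is invertible, as otherwise almost every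
  \<open>x\<close> would lie in a single hyperplane, and inverting it exhibits \<open>T\<close> as an affine map.
\<close>

section \<open>Positive definite matrices and log-densities\<close>

lemma matrix_inv_both:
  fixes S :: "real ^ 'n ^ 'n"
  assumes "invertible S"
  shows "S ** matrix_inv S = mat 1" "matrix_inv S ** S = mat 1"
proof -
  have "S ** matrix_inv S = mat 1 \<and> matrix_inv S ** S = mat 1"
    using assms unfolding invertible_def matrix_inv_def by (rule someI_ex)
  then show "S ** matrix_inv S = mat 1" "matrix_inv S ** S = mat 1"
    by auto
qed

lemma sym_pos_def_invertible:
  assumes "S \<in> sym_pos_def"
  shows "invertible S"
proof -
  have "x = 0" if "S *v x = 0" for x
    using assms that by (force simp: sym_pos_def_def)
  then show ?thesis
    by (simp add: invertible_left_inverse matrix_left_invertible_ker)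
qed

lemma sym_pos_def_inner_commute:
  assumes "S \<in> sym_pos_def"
  shows "x \<bullet> (S *v y) = y \<bullet> (S *v x)"
proof -
  have "x \<bullet> (S *v y) = (transpose S *v x) \<bullet> y"
    by (simp add: dot_lmul_matrix)
  also have "\<dots> = y \<bullet> (S *v x)"
    using assms by (simp add: sym_pos_def_def inner_commute)
  finally show ?thesis .
qed

lemma sym_pos_def_matrix_inv:
  assumes "S \<in> sym_pos_def"
  shows "matrix_inv S \<in> sym_pos_def"
proof -
  note inv = matrix_inv_both[OF sym_pos_def_invertible[OF assms]]
  have tr: "transpose S = S"
    using assms by (simp add: sym_pos_def_def)
  have "transpose (matrix_inv S) = transpose (matrix_inv S) ** (S ** matrix_inv S)"
    by (simp add: inv)
  also have "\<dots> = transpose (S ** matrix_inv S) ** matrix_inv S"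
    by (simp only: matrix_transpose_mul tr matrix_mul_assoc)
  also have "\<dots> = matrix_inv S"
    by (simp add: inv transpose_mat)
  finally have "transpose (matrix_inv S) = matrix_inv S" .
  moreover have "x \<bullet> (matrix_inv S *v x) > 0" if "x \<noteq> 0" for x
  proof -
    define y where "y = matrix_inv S *v x"
    have x: "x = S *v y"
      by (simp add: y_def matrix_vector_mul_assoc inv)
    with that have "y \<noteq> 0"
      by auto
    then have "y \<bullet> (S *v y) > 0"
      using assms by (simp add: sym_pos_def_def)
    then show ?thesis
      by (simp add: x[symmetric] y_def[symmetric] inner_commute)
  qed
  ultimately show ?thesis
    by (simp add: sym_pos_def_def)
qed

lemma gaussian_density_pos:
  assumes "S \<in> sym_pos_def"
  shows "gaussian_density m S x > 0"
  using sym_pos_def_invertible[OF assms]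
  by (simp add: gaussian_density_def invertible_det_nz)

lemma ln_gaussian_density:
  fixes S :: "real ^ 'n ^ 'n"
  assumes "S \<in> sym_pos_def"
  obtains k where "\<And>m x. ln (gaussian_density m S x) = k - ((x - m) \<bullet> (matrix_inv S *v (x - m))) / 2"
proof
  fix m x
  show "ln (gaussian_density m S x) =
      ln ((2 * pi) powr (- real CARD('n) / 2) * det S powr (- 1 / 2)) - ((x - m) \<bullet> (matrix_inv S *v (x - m))) / 2"
    using sym_pos_def_invertible[OF assms]
    by (simp add: gaussian_density_def invertible_det_nz ln_mult)
qed

lemma measurable_gaussian_density [measurable]:
  "gaussian_density m S \<in> borel_measurable borel"
proof -
  have "continuous_on UNIV (gaussian_density m S)"
    unfolding gaussian_density_def
    by (intro continuous_intros linear_continuous_on_compose[where f = "\<lambda>x. x - m"])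
       (auto intro!: continuous_intros)
  then show ?thesis
    by (rule borel_measurable_continuous_onI)
qed

text \<open>
  Second differences remove the affine part of a log-density and leave only the covariance, so they
  allow two log-densities with different means to be compared without expanding either.
\<close>

lemma ln_gaussian_density_second_difference:
  assumes "S \<in> sym_pos_def"
  shows "ln (gaussian_density m S (x + v)) + ln (gaussian_density m S (x - v)) =
         2 * ln (gaussian_density m S x) - v \<bullet> (matrix_inv S *v v)"
proof -
  obtain k where k: "\<And>m x. ln (gaussian_density m S x) =
      k - ((x - m) \<bullet> (matrix_inv S *v (x - m))) / 2"
    using ln_gaussian_density[OF assms] by blast
  define y where "y = x - m"
  have *: "x + v - m = y + v" "x - v - m = y - v" "x - m = y"
    by (auto simp: y_def)
  show ?thesis
    unfolding k *
    by (simp add: matrix_vector_right_distrib matrix_vector_mult_diff_distrib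
        inner_add_left inner_add_right inner_diff_left inner_diff_right field_simps)
qed

lemma ln_gaussian_density_difference_affine:
  assumes S: "S \<in> sym_pos_def" and S': "S' \<in> sym_pos_def"
    and eq: "matrix_inv S' = matrix_inv S"
  obtains d where "\<And>x. ln (gaussian_density m' S' x) - ln (gaussian_density m S x) =
                       (matrix_inv S *v (m' - m)) \<bullet> x + d"
proof -
  obtain k where k: "\<And>m x. ln (gaussian_density m S x) =
      k - ((x - m) \<bullet> (matrix_inv S *v (x - m))) / 2"
    using ln_gaussian_density[OF S] by blast
  obtain k' where k': "\<And>m x. ln (gaussian_density m S' x) =
      k' - ((x - m) \<bullet> (matrix_inv S' *v (x - m))) / 2"
    using ln_gaussian_density[OF S'] by blast
  note com = sym_pos_def_inner_commute[OF sym_pos_def_matrix_inv[OF S]]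
  show thesis
  proof (rule that)
    fix x
    show "ln (gaussian_density m' S' x) - ln (gaussian_density m S x) = (matrix_inv S *v (m' - m)) \<bullet> x
      + (k' - k - (m' \<bullet> (matrix_inv S *v m')) / 2 + (m \<bullet> (matrix_inv S *v m)) / 2)"
      unfolding k k' eq
      using com[of x m] com[of x m']
      by (simp add: matrix_vector_mult_diff_distrib inner_diff_left inner_diff_right
          inner_commute[of "_ *v _"] field_simps)
  qed
qed

text \<open>
  Completing the square: tilting one Gaussian by a power of its likelihood ratio against another one
  with the same covariance is a translation, up to a constant factor.  This holds for every real
  exponent \<open>t\<close>, not only in the convex range, because the coefficients \<open>t\<close> and \<open>1 - t\<close> sum to one
  and so preserve the quadratic part.
\<close>

lemma ln_gaussian_density_affine_combination:
  assumes S: "S \<in> sym_pos_def"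
  obtains k c where "\<And>x. t * ln (gaussian_density a S x) + (1 - t) * ln (gaussian_density b S x) =
                       k + ln (gaussian_density c S x)"
proof -
  obtain k where k: "\<And>m x. ln (gaussian_density m S x) =
      k - ((x - m) \<bullet> (matrix_inv S *v (x - m))) / 2"
    using ln_gaussian_density[OF S] by blast
  note com = sym_pos_def_inner_commute[OF sym_pos_def_matrix_inv[OF S]]
  let ?B = "\<lambda>x y. x \<bullet> (matrix_inv S *v y)"
  define c where "c = t *\<^sub>R a + (1 - t) *\<^sub>R b"
  have sq: "?B (x - m) (x - m) = ?B x x - 2 * ?B x m + ?B m m" for x m
    using com[of x m]
    by (simp add: matrix_vector_mult_diff_distrib inner_diff_left inner_diff_right)
  have lin: "?B x c = t * ?B x a + (1 - t) * ?B x b" for x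
    by (simp add: c_def matrix_vector_right_distrib inner_add_right matrix_vector_mult_scaleR)
  show thesis
  proof (rule that)
    fix x
    show "t * ln (gaussian_density a S x) + (1 - t) * ln (gaussian_density b S x) =
        (?B c c - t * ?B a a - (1 - t) * ?B b b) / 2 + ln (gaussian_density c S x)"
      unfolding k sq lin[of x] by (simp add: field_simps)
  qed
qed

section \<open>Integrals of exponentials\<close>

lemma nn_integral_exp_neg_square_finite:
  assumes "c > 0"
  shows "(\<integral>\<^sup>+(x::real). ennreal (exp (- c * x\<^sup>2)) \<partial>lborel) < \<infinity>"
proof -
  define s where "s = sqrt (1 / (2 * c))"
  have s: "s > 0" "s\<^sup>2 = 1 / (2 * c)"
    using assms by (auto simp: s_def)
  have "integrable lborel (\<lambda>x. sqrt (2 * pi * s\<^sup>2) * normal_density 0 s x)"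
    using integrable_normal_density[OF s(1), of 0] by simp
  also have "(\<lambda>x. sqrt (2 * pi * s\<^sup>2) * normal_density 0 s x) = (\<lambda>x. exp (- c * x\<^sup>2))"
    using assms s by (auto simp: normal_density_def field_simps)
  finally show ?thesis
    by (simp add: integrable_iff_bounded)
qed

text \<open>
  A positive definite form is bounded below by a multiple of the squared norm, with half its minimum
  on the unit sphere as the rate of Gaussian decay, and the resulting isotropic bound factors into one-dimensional Gaussian integrals.
\<close>

lemma nn_integral_gaussian_density_finite:
  fixes S :: "real ^ 'n ^ 'n"
  assumes S: "S \<in> sym_pos_def"
  shows "(\<integral>\<^sup>+x. ennreal (gaussian_density m S x) \<partial>lborel) < \<infinity>"
proof -
  let ?Q = "\<lambda>x. x \<bullet> (matrix_inv S *v x)"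
  have pos: "?Q x > 0" if "x \<noteq> 0" for x
    using sym_pos_def_matrix_inv[OF S] that by (simp add: sym_pos_def_def)
  have cont: "continuous_on (sphere 0 1) ?Q"
    by (intro continuous_on_inner continuous_on_id matrix_vector_mult_linear_continuous_on)
  have ne: "sphere (0::real^'n) 1 \<noteq> {}"
    by simp
  obtain u where u: "u \<in> sphere 0 1" "\<And>y. y \<in> sphere 0 1 \<Longrightarrow> ?Q u \<le> ?Q y"
    using continuous_attains_inf[OF compact_sphere ne cont] by blast
  define c where "c = ?Q u / 2"
  have "c > 0"
    using pos[of u] u(1) by (force simp: c_def)
  have lower: "2 * c * (norm x)\<^sup>2 \<le> ?Q x" for x
  proof (cases "x = 0")
    case False
    define y where "y = x /\<^sub>R norm x"
    have x: "x = norm x *\<^sub>R y"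
      using False by (simp add: y_def)
    have "?Q u \<le> ?Q y"
      using False by (intro u(2)) (simp add: y_def)
    then have "(norm x)\<^sup>2 * ?Q u \<le> (norm x)\<^sup>2 * ?Q y"
      by (intro mult_left_mono) auto
    also have "\<dots> = ?Q (norm x *\<^sub>R y)"
      by (simp add: matrix_vector_mult_scaleR power2_eq_square)
    finally show ?thesis
      using x by (simp add: c_def mult.commute)
  qed simp
  obtain k where k: "\<And>m x. ln (gaussian_density m S x) =
      k - ((x - m) \<bullet> (matrix_inv S *v (x - m))) / 2"
    using ln_gaussian_density[OF S] by blast
  have dens: "gaussian_density m S x = exp k * exp (- ?Q (x - m) / 2)" for x
  proof -
    have "gaussian_density m S x = exp (ln (gaussian_density m S x))"
      using gaussian_density_pos[OF S, of m x] by simp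
    also have "\<dots> = exp k * exp (- ?Q (x - m) / 2)"
      unfolding k by (simp flip: exp_add)
    finally show ?thesis .
  qed
  have dens_le: "gaussian_density m S x \<le> exp k * exp (- c * (norm (x - m))\<^sup>2)" for x
    using lower[of "x - m"] by (simp add: dens)
  have "(\<integral>\<^sup>+x. ennreal (gaussian_density m S x) \<partial>lborel)
      \<le> (\<integral>\<^sup>+x. ennreal (exp k) * ennreal (exp (- c * (norm (x - m))\<^sup>2)) \<partial>lborel)"
    by (intro nn_integral_mono)
       (use dens_le in \<open>simp add: ennreal_mult[symmetric] ennreal_leI\<close>)
  also have "\<dots> = ennreal (exp k) * (\<integral>\<^sup>+x. ennreal (exp (- c * (norm (x - m))\<^sup>2)) \<partial>lborel)"
    by (intro nn_integral_cmult) simp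
  also have "(\<integral>\<^sup>+x. ennreal (exp (- c * (norm (x - m))\<^sup>2)) \<partial>lborel)
      = (\<integral>\<^sup>+(x::real^'n). ennreal (exp (- c * (norm x)\<^sup>2)) \<partial>lborel)"
    by (subst lborel_distr_plus[symmetric, of m], subst nn_integral_distr) auto
  also have "\<dots> = (\<integral>\<^sup>+(x::real^'n). (\<Prod>b\<in>Basis. ennreal (exp (- c * (x \<bullet> b)\<^sup>2))) \<partial>lborel)"
  proof (intro nn_integral_cong)
    fix x :: "real^'n"
    have "(norm x)\<^sup>2 = (\<Sum>b\<in>Basis. (x \<bullet> b)\<^sup>2)"
      unfolding power2_norm_eq_inner by (subst euclidean_inner) (simp add: power2_eq_square)
    then have "exp (- c * (norm x)\<^sup>2) = (\<Prod>b\<in>Basis. exp (- c * (x \<bullet> b)\<^sup>2))"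
      by (simp only: sum_distrib_left exp_sum[OF finite_Basis])
    then show "ennreal (exp (- c * (norm x)\<^sup>2)) = (\<Prod>b\<in>Basis. ennreal (exp (- c * (x \<bullet> b)\<^sup>2)))"
      by (simp add: prod_ennreal)
  qed
  also have "\<dots> = (\<Prod>b\<in>(Basis::(real^'n) set). (\<integral>\<^sup>+x. ennreal (exp (- c * x\<^sup>2)) \<partial>lborel))"
    by (rule nn_integral_lborel_prod) auto
  also have "ennreal (exp k) * \<dots> < \<infinity>"
    using nn_integral_exp_neg_square_finite[OF \<open>c > 0\<close>]
    by (auto simp: ennreal_mult_less_top power_less_top_ennreal)
  finally show ?thesis .
qed

lemma not_AE_lborel_False: "\<not> (AE x in (lborel :: 'a::euclidean_space measure). False)"
  using ae_filter_eq_bot_iff[of "lborel :: 'a measure"]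
  by (simp add: trivial_limit_def[symmetric] trivial_limit_eq)

text \<open>
  By the inequality of arithmetic and geometric means, averaging \<open>exp p\<close> over the translations by
  \<open>v\<close> and \<open>- v\<close> multiplies it by at least \<open>exp \<kappa> > 1\<close> at every point, whereas translations leave the
  integral unchanged.  A positive finite integral cannot satisfy both.
\<close>

lemma nn_integral_exp_eq_top_if_second_difference_pos:
  fixes p :: "'a::euclidean_space \<Rightarrow> real"
  assumes [measurable]: "p \<in> borel_measurable borel"
    and "\<kappa> > 0"
    and conv: "\<And>x. p (x + v) + p (x - v) = 2 * p x + 2 * \<kappa>"
  shows "(\<integral>\<^sup>+x. ennreal (exp (p x)) \<partial>lborel) = \<infinity>"
proof (rule ccontr)
  let ?I = "\<integral>\<^sup>+x. ennreal (exp (p x)) \<partial>lborel"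
  assume "?I \<noteq> \<infinity>"
  have shift: "(\<integral>\<^sup>+x. ennreal (exp (p (x + w))) \<partial>lborel) = ?I" for w
    by (subst (2) lborel_distr_plus[symmetric, of w], subst nn_integral_distr)
       (auto simp: add.commute)
  have pointwise: "2 * exp \<kappa> * exp (p x) \<le> exp (p (x + v)) + exp (p (x - v))" for x
  proof -
    have "2 * exp \<kappa> * exp (p x) = 2 * (exp (p (x + v) / 2) * exp (p (x - v) / 2))"
      using conv[of x] by (simp flip: exp_add add: field_simps)
    also have "\<dots> \<le> (exp (p (x + v) / 2))\<^sup>2 + (exp (p (x - v) / 2))\<^sup>2"
      using sum_squares_bound by (simp add: mult.assoc)
    also have "\<dots> = exp (p (x + v)) + exp (p (x - v))"
      by (simp flip: exp_of_nat_mult exp_double)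
    finally show ?thesis .
  qed
  have "ennreal (2 * exp \<kappa>) * ?I = (\<integral>\<^sup>+x. ennreal (2 * exp \<kappa> * exp (p x)) \<partial>lborel)"
    by (subst nn_integral_cmult[symmetric]) (auto simp: ennreal_mult)
  also have "\<dots> \<le> (\<integral>\<^sup>+x. ennreal (exp (p (x + v))) + ennreal (exp (p (x - v))) \<partial>lborel)"
    by (intro nn_integral_mono)
       (use pointwise in \<open>auto simp: ennreal_plus[symmetric] simp del: ennreal_plus intro!: ennreal_leI\<close>)
  also have "\<dots> = ?I + ?I"
    using shift[of v] shift[of "- v"] by (subst nn_integral_add) auto
  also have "\<dots> = ennreal 2 * ?I"
    by (simp add: mult_2)
  finally have le: "ennreal (2 * exp \<kappa>) * ?I \<le> ennreal 2 * ?I" .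
  obtain r where r: "?I = ennreal r" "r \<ge> 0"
    using \<open>?I \<noteq> \<infinity>\<close> by (cases ?I) auto
  have "?I \<noteq> 0"
    using not_AE_lborel_False[where 'a = 'a] by (subst nn_integral_0_iff_AE) auto
  then have "r > 0"
    using r by (cases "r = 0") auto
  have "2 * exp \<kappa> * r \<le> 2 * r"
    using le r by (simp add: ennreal_mult[symmetric] del: ennreal_numeral)
  then show False
    using \<open>r > 0\<close> \<open>\<kappa> > 0\<close> by simp
qed

section \<open>Change of variables\<close>

lemma distr_inj_on_borel_automorphism:
  assumes T: "borel_automorphism T"
    and "sets M = sets borel" "sets N = sets borel"
    and eq: "distr M borel T = distr N borel T"
  shows "M = N"
proof -
  have [measurable]: "T \<in> borel_measurable borel" "inv T \<in> borel_measurable borel"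
    and bij: "bij T"
    using T by (auto simp: borel_automorphism_def)
  have undo: "distr (distr K borel T) borel (inv T) = K" if K: "sets K = sets borel" for K
  proof -
    have [measurable_cong]: "sets K = sets borel"
      by fact
    have "distr (distr K borel T) borel (inv T) = distr K borel (inv T \<circ> T)"
      by (subst distr_distr) auto
    also have "inv T \<circ> T = (\<lambda>x. x)"
      using bij by (auto simp: bij_def)
    finally show ?thesis
      using K by (simp add: distr_id2)
  qed
  show ?thesis
    using undo[of M] undo[of N] assms by metis
qed

text \<open>
  Reweighting the image of a measure by \<open>s\<close> amounts to reweighting the measure by \<open>s \<circ> T\<close> first.  With
  \<open>s = g' / g\<close> the reweighted image is the image of the second measure, and since \<open>T\<close> is a Borel
  isomorphism the two reweighted sources must already agree; almost-everywhere uniqueness of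
  densities then identifies the ratios.
\<close>

lemma density_ratio_transported:
  fixes f f' g g' :: "'a::euclidean_space \<Rightarrow> real"
  assumes T: "borel_automorphism T"
    and [measurable]: "f \<in> borel_measurable borel" "f' \<in> borel_measurable borel"
      "g \<in> borel_measurable borel" "g' \<in> borel_measurable borel"
    and pos: "\<And>x. f x > 0" "\<And>x. f' x > 0" "\<And>x. g x > 0" "\<And>x. g' x > 0"
    and fin: "(\<integral>\<^sup>+x. ennreal (f' x) \<partial>lborel) < \<infinity>"
    and distr: "distr (density lborel f) borel T = density lborel g"
    and distr': "distr (density lborel f') borel T = density lborel g'"
  shows "AE x in lborel. f' x / f x = g' (T x) / g (T x)"
proof -
  have [measurable]: "T \<in> borel_measurable borel"
    using T by (auto simp: borel_automorphism_def)
  have mult_ratio: "ennreal a * ennreal (b / a) = ennreal b" if "a > 0" "b > 0" for a b :: real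
    using that by (simp add: ennreal_mult[symmetric])
  let ?M = "density lborel f" and ?N = "density lborel g"
  let ?r = "\<lambda>x. ennreal (f' x / f x)" and ?s = "\<lambda>y. ennreal (g' y / g y)"
  have M: "density ?M ?r = density lborel f'"
    using pos by (subst density_density_eq)
      (auto simp: ennreal_mult[symmetric] less_imp_le less_imp_neq[symmetric]  intro!: density_cong)
  have N: "density ?N ?s = density lborel g'"
    by (subst density_density_eq) (auto simp: mult_ratio pos intro!: density_cong)
  have "density (distr ?M borel T) ?s = distr (density ?M (\<lambda>x. ?s (T x))) borel T"
    by (rule density_distr) measurable
  then have "distr (density ?M (\<lambda>x. ?s (T x))) borel T = distr (density ?M ?r) borel T"
    unfolding distr M N distr' by (rule sym)
  then have "density ?M (\<lambda>x. ?s (T x)) = density ?M ?r"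
    by (rule distr_inj_on_borel_automorphism[OF T, rotated 2]) simp_all
  moreover have "(\<integral>\<^sup>+x. ?r x \<partial>?M) \<noteq> \<infinity>"
    using fin arg_cong[OF M, of "\<lambda>K. emeasure K UNIV"] by (simp add: emeasure_density)
  ultimately have "AE x in ?M. ?r x = ?s (T x)"
    by (subst finite_density_unique[symmetric]) auto
  then have "AE x in lborel. ?r x = ?s (T x)"
    using pos by (simp add: AE_density)
  then show ?thesis
    by eventually_elim (use pos in \<open>auto simp: less_imp_le\<close>)
qed

section \<open>Equality of the image covariances\<close>

text \<open>
  The logarithm \<open>?q\<close> of the image ratio becomes the affine function \<open>?l\<close> after composition
  with \<open>T\<close>, so it has all exponential moments under the image measure.  This forbids it from
  having a quadratic part of either sign in any direction, which is the asserted equality.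
\<close>

lemma image_covariance_inverse_eq:
  fixes T :: "real ^ 'n \<Rightarrow> real ^ 'n"
  assumes T: "borel_automorphism T"
    and S: "S \<in> sym_pos_def" and P: "P \<in> sym_pos_def" and P': "P' \<in> sym_pos_def"
    and distr: "distr (gaussian_measure m S) borel T = gaussian_measure \<phi> P"
    and ratio: "AE x in lborel. gaussian_density m' S x / gaussian_density m S x =
                  gaussian_density \<phi>' P' (T x) / gaussian_density \<phi> P (T x)"
  shows "matrix_inv P' = matrix_inv P"
proof -
  have [measurable]: "T \<in> borel_measurable borel"
    using T by (auto simp: borel_automorphism_def)
  note pos = gaussian_density_pos
  let ?q = "\<lambda>y. ln (gaussian_density \<phi>' P' y) - ln (gaussian_density \<phi> P y)"
  let ?l = "\<lambda>x. ln (gaussian_density m' S x) - ln (gaussian_density m S x)"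
  have "AE x in lborel. ?l x = ?q (T x)"
    using ratio
  proof eventually_elim
    case (elim x)
    then have "ln (gaussian_density m' S x / gaussian_density m S x) =
        ln (gaussian_density \<phi>' P' (T x) / gaussian_density \<phi> P (T x))"
      by (rule arg_cong)
    then show ?case
      by (simp only: ln_divide_pos pos S P P')
  qed
  then have "AE x in lborel. 0 < ennreal (gaussian_density m S x) \<longrightarrow> ?q (T x) = ?l x"
    by eventually_elim simp
  then have l_q: "AE x in gaussian_measure m S. ?q (T x) = ?l x"
    unfolding gaussian_measure_def by (subst AE_density) simp_all
  have finite: "(\<integral>\<^sup>+y. ennreal (exp (t * ?q y + ln (gaussian_density \<phi> P y))) \<partial>lborel) < \<infinity>" for t
  proof -
    obtain k c where k: "\<And>x. t * ln (gaussian_density m' S x) + (1 - t) * ln (gaussian_density m S x) =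
        k + ln (gaussian_density c S x)"
      using ln_gaussian_density_affine_combination[OF S] by blast
    have mult: "gaussian_density m S x * exp (t * ?l x) = exp k * gaussian_density c S x" for x
    proof -
      have "gaussian_density m S x * exp (t * ?l x) = exp (ln (gaussian_density m S x) + t * ?l x)"
        using pos[OF S, of m x] by (simp add: exp_add)
      also have "ln (gaussian_density m S x) + t * ?l x = k + ln (gaussian_density c S x)"
        using k[of x] by (simp add: algebra_simps)
      finally show ?thesis
        using pos[OF S, of c x] by (simp add: exp_add)
    qed
    have "(\<integral>\<^sup>+y. ennreal (exp (t * ?q y + ln (gaussian_density \<phi> P y))) \<partial>lborel)
        = (\<integral>\<^sup>+y. ennreal (exp (t * ?q y)) \<partial>gaussian_measure \<phi> P)"
      unfolding gaussian_measure_def using pos[OF P, of \<phi>]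
      by (subst nn_integral_density) (auto simp: exp_add ennreal_mult less_imp_le mult.commute)
    also have "\<dots> = (\<integral>\<^sup>+x. ennreal (exp (t * ?q (T x))) \<partial>gaussian_measure m S)"
      by (subst distr[symmetric], subst nn_integral_distr) (auto simp: gaussian_measure_def)
    also have "\<dots> = (\<integral>\<^sup>+x. ennreal (exp (t * ?l x)) \<partial>gaussian_measure m S)"
      by (intro nn_integral_cong_AE) (use l_q in eventually_elim, simp)
    also have "\<dots> = (\<integral>\<^sup>+x. ennreal (gaussian_density m S x * exp (t * ?l x)) \<partial>lborel)"
      unfolding gaussian_measure_def using pos[OF S, of m]
      by (subst nn_integral_density) (auto simp: ennreal_mult less_imp_le)
    also have "\<dots> = (\<integral>\<^sup>+x. ennreal (exp k) * ennreal (gaussian_density c S x) \<partial>lborel)"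
      by (simp only: mult) (simp add: ennreal_mult')
    also have "\<dots> = ennreal (exp k) * (\<integral>\<^sup>+x. ennreal (gaussian_density c S x) \<partial>lborel)"
      by (intro nn_integral_cmult) simp
    also have "\<dots> < \<infinity>"
      using nn_integral_gaussian_density_finite[OF S] by (simp add: ennreal_mult_less_top)
    finally show ?thesis .
  qed
  have form_eq: "v \<bullet> (matrix_inv P' *v v) = v \<bullet> (matrix_inv P *v v)" for v
  proof (rule ccontr)
    define \<beta> where "\<beta> = v \<bullet> (matrix_inv P *v v) - v \<bullet> (matrix_inv P' *v v)"
    assume "v \<bullet> (matrix_inv P' *v v) \<noteq> v \<bullet> (matrix_inv P *v v)"
    then have "\<beta> \<noteq> 0"
      by (simp add: \<beta>_def)
    (* This choice makes the second difference of the exponent ?p along v equal to the positive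
       number 2: the first summand of t * \<beta> cancels the concavity of the logarithm of the
       Gaussian weight.  The sign of \<beta> is arbitrary because t may be negative. *)
    define t where "t = (v \<bullet> (matrix_inv P *v v) + 2) / \<beta>"
    have t: "t * \<beta> = v \<bullet> (matrix_inv P *v v) + 2"
      using \<open>\<beta> \<noteq> 0\<close> by (simp add: t_def)
    let ?p = "\<lambda>y. t * ?q y + ln (gaussian_density \<phi> P y)"
    have "(\<integral>\<^sup>+y. ennreal (exp (?p y)) \<partial>lborel) = \<infinity>"
    proof (rule nn_integral_exp_eq_top_if_second_difference_pos[where v = v and \<kappa> = 1])
      fix y
      note d = ln_gaussian_density_second_difference[OF P, of \<phi> y v]
      note d' = ln_gaussian_density_second_difference[OF P', of \<phi>' y v]
      have q: "?q (y + v) + ?q (y - v) = 2 * ?q y + \<beta>"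
        using d d' by (simp add: \<beta>_def)
      have "?p (y + v) + ?p (y - v) = t * (?q (y + v) + ?q (y - v)) +
          (ln (gaussian_density \<phi> P (y + v)) + ln (gaussian_density \<phi> P (y - v)))"
        by (simp add: algebra_simps)
      also have "\<dots> = 2 * ?p y + 2 * 1"
        unfolding q d using t by (simp add: algebra_simps)
      finally show "?p (y + v) + ?p (y - v) = 2 * ?p y + 2 * 1" .
    qed auto
    with finite[of t] show False
      by simp
  qed
  (* Polarisation: a symmetric matrix is determined by its quadratic form. *)
  have bilinear_eq: "u \<bullet> (matrix_inv P' *v v) = u \<bullet> (matrix_inv P *v v)" for u v
    using form_eq[of "u + v"] form_eq[of u] form_eq[of v]
      sym_pos_def_inner_commute[OF sym_pos_def_matrix_inv[OF P], of u v]
      sym_pos_def_inner_commute[OF sym_pos_def_matrix_inv[OF P'], of u v]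
    by (simp add: matrix_vector_right_distrib inner_add_left inner_add_right)
  then have "matrix_inv P' *v v = matrix_inv P *v v" for v
    by (metis vector_eq_ldot)
  then show ?thesis
    by (simp add: matrix_eq)
qed

section \<open>Affinity of the transformation\<close>

text \<open>
  The relation expresses \<open>x\<close> through \<open>T x\<close>, not conversely, and nothing yet says that \<open>N\<close> loses no
  information.  If it did, a vector orthogonal to its range would confine almost every \<open>x\<close> to a
  hyperplane.
\<close>

lemma affine_of_AE_left_affine:
  fixes T :: "real ^ 'n \<Rightarrow> real ^ 'n" and N :: "real ^ 'n ^ 'n"
  assumes ae: "AE x in lborel. x = N *v T x + d"
  shows "\<exists>A a. invertible A \<and> (AE x in lborel. T x = A *v x + a)"
proof -
  have "invertible N"
  proof (rule ccontr)
    assume "\<not> invertible N"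
    then have "\<not> invertible (transpose N)"
      using transpose_invertible transpose_transpose by metis
    then obtain w where w: "transpose N *v w = 0" "w \<noteq> 0"
      by (auto simp: invertible_left_inverse matrix_left_invertible_ker)
    have orth: "w \<bullet> (N *v y) = 0" for y
      using w(1) dot_lmul_matrix[of w N y] by simp
    from ae have "AE x in lborel. w \<bullet> x = w \<bullet> d"
      by eventually_elim (metis add_0 inner_add_right orth)
    then have "AE x in lebesgue. w \<bullet> x = w \<bullet> d"
      by (rule AE_completion)
    moreover have "AE x in lebesgue. x \<notin> {x. w \<bullet> x = w \<bullet> d}"
      using negligible_hyperplane[of w "w \<bullet> d"] w(2)
      by (intro AE_not_in) (simp add: negligible_iff_null_sets)
    ultimately have "AE x in (lebesgue :: (real ^ 'n) measure). False"
      by eventually_elim auto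
    then show False
      using not_AE_lborel_False[where 'a = "real ^ 'n"] by (simp add: AE_completion_iff)
  qed
  note inv = matrix_inv_both[OF this]
  have "AE x in lborel. T x = matrix_inv N *v x + - (matrix_inv N *v d)"
    using ae
  proof eventually_elim
    case (elim x)
    then have "matrix_inv N *v x = matrix_inv N *v (N *v T x + d)"
      by simp
    then show ?case
      by (simp add: matrix_vector_right_distrib matrix_vector_mul_assoc inv)
  qed
  moreover have "invertible (matrix_inv N)"
    using inv by (auto simp: invertible_def)
  ultimately show ?thesis
    by blast
qed

theorem corollary3p2:
  fixes T :: "real ^ 'n \<Rightarrow> real ^ 'n"
    and \<theta> :: "nat \<Rightarrow> real ^ 'n"
  assumes "borel_automorphism T"
    and "independent {\<theta> j - \<theta> 0 | j. 1 \<le> j \<and> j \<le> CARD('n)}"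
    and "span {\<theta> j - \<theta> 0 | j. 1 \<le> j \<and> j \<le> CARD('n)} = UNIV"
    and "\<exists>\<Sigma>\<in>sym_pos_def. \<forall>j\<le>CARD('n). \<exists>\<phi>. \<exists>\<Psi>\<in>sym_pos_def.
           distr (gaussian_measure (\<theta> j) \<Sigma>) borel T = gaussian_measure \<phi> \<Psi>"
  shows "\<exists>A a. invertible A \<and> (AE x in lebesgue. T x = A *v x + a)"
proof -
  obtain S where S: "S \<in> sym_pos_def"
    and ex: "\<And>j. j \<le> CARD('n) \<Longrightarrow> \<exists>\<phi>. \<exists>\<Psi>\<in>sym_pos_def.
           distr (gaussian_measure (\<theta> j) S) borel T = gaussian_measure \<phi> \<Psi>"
    using assms(4) by blast
  note inv = matrix_inv_both[OF sym_pos_def_invertible[OF S]]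
  obtain \<phi> P where P: "P \<in> sym_pos_def"
    and distr: "distr (gaussian_measure (\<theta> 0) S) borel T = gaussian_measure \<phi> P"
    using ex[of 0] by auto
  (* The vectors w with this property form a linear subspace, so it is enough to check it on the
     spanning set. *)
  define good where
    "good w \<longleftrightarrow> (\<exists>n d. AE x in lborel. (matrix_inv S *v w) \<bullet> x = n \<bullet> T x + d)" for w
  have generators: "good (\<theta> j - \<theta> 0)" if j: "j \<le> CARD('n)" for j
  proof -
    obtain \<phi>' P' where P': "P' \<in> sym_pos_def"
      and distr': "distr (gaussian_measure (\<theta> j) S) borel T = gaussian_measure \<phi>' P'"
      using ex[OF j] by auto
    have ratio: "AE x in lborel. gaussian_density (\<theta> j) S x / gaussian_density (\<theta> 0) S x =
                  gaussian_density \<phi>' P' (T x) / gaussian_density \<phi> P (T x)"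
      using distr distr' unfolding gaussian_measure_def
      by (intro density_ratio_transported[OF assms(1)] gaussian_density_pos S P P'
          nn_integral_gaussian_density_finite measurable_gaussian_density)
    have P_eq: "matrix_inv P' = matrix_inv P"
      using image_covariance_inverse_eq[OF assms(1) S P P' distr ratio] .
    obtain c where c: "\<And>x. ln (gaussian_density (\<theta> j) S x) - ln (gaussian_density (\<theta> 0) S x) =
        (matrix_inv S *v (\<theta> j - \<theta> 0)) \<bullet> x + c"
      using ln_gaussian_density_difference_affine[OF S S refl] by blast
    obtain d where d: "\<And>x. ln (gaussian_density \<phi>' P' x) - ln (gaussian_density \<phi> P x) =
        (matrix_inv P *v (\<phi>' - \<phi>)) \<bullet> x + d"
      using ln_gaussian_density_difference_affine[OF P P' P_eq] by blast
    have "AE x in lborel. (matrix_inv S *v (\<theta> j - \<theta> 0)) \<bullet> x =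
        (matrix_inv P *v (\<phi>' - \<phi>)) \<bullet> T x + (d - c)"
      using ratio
    proof eventually_elim
      case (elim x)
      then have "ln (gaussian_density (\<theta> j) S x / gaussian_density (\<theta> 0) S x) =
          ln (gaussian_density \<phi>' P' (T x) / gaussian_density \<phi> P (T x))"
        by (rule arg_cong)
      then have "ln (gaussian_density (\<theta> j) S x) - ln (gaussian_density (\<theta> 0) S x) =
          ln (gaussian_density \<phi>' P' (T x)) - ln (gaussian_density \<phi> P (T x))"
        by (simp only: ln_divide_pos gaussian_density_pos S P P')
      then show ?case
        unfolding c d by simp
    qed
    then show ?thesis
      unfolding good_def by blast
  qed
  have good_0: "good 0"
    unfolding good_def by (intro exI[of _ 0]) simp
  have good_add: "good (c *\<^sub>R u + w)" if u: "good u" and w: "good w" for c u w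
  proof -
    obtain n d where nd: "AE x in lborel. (matrix_inv S *v u) \<bullet> x = n \<bullet> T x + d"
      using u by (auto simp: good_def)
    obtain n' d' where nd': "AE x in lborel. (matrix_inv S *v w) \<bullet> x = n' \<bullet> T x + d'"
      using w by (auto simp: good_def)
    from nd nd' have "AE x in lborel. (matrix_inv S *v (c *\<^sub>R u + w)) \<bullet> x =
        (c *\<^sub>R n + n') \<bullet> T x + (c * d + d')"
      by eventually_elim
         (simp add: matrix_vector_right_distrib matrix_vector_mult_scaleR inner_add_left algebra_simps)
    then show ?thesis
      unfolding good_def by blast
  qed
  have good: "good w" for w
  proof -
    have "w \<in> span {\<theta> j - \<theta> 0 | j. 1 \<le> j \<and> j \<le> CARD('n)}"
      using assms(3) by simp
    then show ?thesis
      by (induction rule: span_induct_alt) (use good_0 good_add generators in auto)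
  qed
  (* The vector S *v axis i 1 is chosen so that applying matrix_inv S returns the coordinate
     vector axis i 1. *)
  have "\<exists>n d. AE x in lborel. x $ i = n \<bullet> T x + d" for i :: 'n
    using good[of "S *v axis i 1"]
    by (simp add: good_def matrix_vector_mul_assoc inv inner_axis')
  then obtain n d where nd: "\<And>i::'n. AE x in lborel. x $ i = n i \<bullet> T x + d i"
    by metis
  then have "AE x in lborel. \<forall>i. x $ i = n i \<bullet> T x + d i"
    by (simp add: AE_all_countable)
  then have "AE x in lborel. x = (\<chi> i. n i) *v T x + (\<chi> i. d i)"
    by eventually_elim
       (simp add: vec_eq_iff matrix_vector_mult_def inner_vec_def)
  from affine_of_AE_left_affine[OF this] show ?thesis
    using AE_completion by blast
qed

end
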